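(* Let $X$ be a non-empty set. The heap $\mathcal{H}(X)$ is the free heap on $X$: for any heap $H$ and any function $\varphi:X\to H$ there exists a unique heap morphism $\widehat{\varphi}:\mathcal{H}(X)\to H$ such that $\widehat{\varphi}\circ\iota_X=\varphi$, where $\iota_X:X\to\mathcal{H}(X)$ is the inclusion of $X$ as one-letter words.
   Context: A heap is a set $H$ with a ternary operation $[-,-,-]$ such that $[[a,b,c],d,e]=[a,b,[c,d,e]]$ and $[a,b,b]=a=[b,b,a]$ for all $a,b,c,d,e\in H$. Heap morphisms are maps preserving the ternary operation. For a non-empty set $X$, $W(X)$ is the set of reduced words in $X$, i.e. all odd-length words $x_1x_2\ldots x_{2n+1}$, $n\geq 0$, in elements of $X$ with $x_i\neq x_{i+1}$ for all $i$. For a word $w=x_1x_2\ldots x_{2n+1}$, its opposite is $w^\circ=x_{2n+1}x_{2n}\ldots x_1$. The heap $\mathcal{H}(X)$ is the set $W(X)$ with ternary operation $[u,v,w]$ defined as the reduced word obtained from the concatenation $u\,v^\circ\, w$ by systematically removing all pairs of consecutive identical letters. *)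

theory Defs
  imports "HOL-Library.FuncSet" "HOL-Algebra.Congruence"
begin

record 'a heap = "'a partial_object" +
  bracket :: "'a \<Rightarrow> 'a \<Rightarrow> 'a \<Rightarrow> 'a"

text \<open>The carrier of a heap may be empty.\<close>

locale heap =
  fixes H :: "('a, 'm) heap_scheme"
  assumes bracket_closed:
      "\<lbrakk>a \<in> carrier H; b \<in> carrier H; c \<in> carrier H\<rbrakk> \<Longrightarrow> bracket H a b c \<in> carrier H"
    and bracket_assoc:
      "\<lbrakk>a \<in> carrier H; b \<in> carrier H; c \<in> carrier H; d \<in> carrier H; e \<in> carrier H\<rbrakk>
        \<Longrightarrow> bracket H (bracket H a b c) d e = bracket H a b (bracket H c d e)"
    and bracket_cancel_right:
      "\<lbrakk>a \<in> carrier H; b \<in> carrier H\<rbrakk> \<Longrightarrow> bracket H a b b = a"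
    and bracket_cancel_left:
      "\<lbrakk>a \<in> carrier H; b \<in> carrier H\<rbrakk> \<Longrightarrow> bracket H b b a = a"

definition heap_hom :: "('a, 'm) heap_scheme \<Rightarrow> ('b, 'n) heap_scheme \<Rightarrow> ('a \<Rightarrow> 'b) set"
  where "heap_hom H K = {f \<in> carrier H \<rightarrow> carrier K.
    \<forall>a \<in> carrier H. \<forall>b \<in> carrier H. \<forall>c \<in> carrier H.
      f (bracket H a b c) = bracket K (f a) (f b) (f c)}"

definition reduced_words :: "'a set \<Rightarrow> 'a list set"
  where "reduced_words X = {w \<in> lists X. odd (length w) \<and> distinct_adj w}"

inductive cancels :: "'a list \<Rightarrow> 'a list \<Rightarrow> bool"
  where "cancels (u @ [x, x] @ v) (u @ v)"

text \<open>The word left when no more pairs of consecutive identical letters can be removed. It does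
  not depend on the order of the removals, see \<open>ex1_reduced_form\<close> below.\<close>

definition reduced_form :: "'a list \<Rightarrow> 'a list"
  where "reduced_form w = (THE r. cancels\<^sup>*\<^sup>* w r \<and> distinct_adj r)"

definition free_heap :: "'a set \<Rightarrow> 'a list heap"
  where "free_heap X =
    \<lparr>carrier = reduced_words X, bracket = (\<lambda>u v w. reduced_form (u @ rev v @ w))\<rparr>"

definition letter :: "'a \<Rightarrow> 'a list"
  where "letter x = [x]"

lemma ex_reduced_form: "\<exists>r. cancels\<^sup>*\<^sup>* w r \<and> distinct_adj r"
proof (induction w rule: length_induct)
  case (1 w)
  show ?case
  proof (cases "distinct_adj w")
    case False
    then obtain u x v where w: "w = u @ [x, x] @ v"
    proof (induction w arbitrary: thesis rule: induct_list012)
      case (3 a b w)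
      show ?case
      proof (cases "a = b")
        case True
        then show ?thesis using "3.prems"(1)[of "[]" a w] by simp
      next
        case False
        then have "\<not> distinct_adj (b # w)" using "3.prems"(2) by simp
        then obtain u x v where "b # w = u @ [x, x] @ v" using "3.IH"(2) by blast
        then show ?thesis using "3.prems"(1)[of "a # u" x v] by simp
      qed
    qed auto
    obtain r where "cancels\<^sup>*\<^sup>* (u @ v) r" "distinct_adj r"
      using 1[rule_format, of "u @ v"] w by auto
    moreover have "cancels w (u @ v)" unfolding w by (rule cancels.intros)
    ultimately show ?thesis by (meson converse_rtranclp_into_rtranclp)
  qed auto
qed

lemma ex1_reduced_form: "\<exists>!r. cancels\<^sup>*\<^sup>* w r \<and> distinct_adj r"
proof -
  define push :: "'a \<Rightarrow> 'a list \<Rightarrow> 'a list"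
    where "push x s = (if s \<noteq> [] \<and> hd s = x then tl s else x # s)" for x s
  have adj: "distinct_adj (push x s)" if "distinct_adj s" for x s
    using that by (cases s) (auto simp: push_def distinct_adj_Cons)
  have adj': "distinct_adj (foldr push v [])" for v
    by (induction v) (simp_all add: adj)
  have push2: "push x (push x s) = s" if "distinct_adj s" for x s
    using that by (cases s) (auto simp: push_def distinct_adj_Cons)
  have step: "foldr push w [] = foldr push w' []" if "cancels w w'" for w w'
    using that by cases (simp add: push2 adj')
  have steps: "foldr push w [] = foldr push w' []" if "cancels\<^sup>*\<^sup>* w w'" for w w'
    using that by induction (simp_all add: step)
  have fixed: "foldr push r [] = r" if "distinct_adj r" for r
    using that by (induction r) (auto simp: push_def distinct_adj_Cons)
  show ?thesis using ex_reduced_form[of w] steps fixed by metis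
qed

end

theory Submission
  imports Defs
begin

text \<open>
  Cancelling first inside a part of a concatenation does not change the reduced form of the whole,
  because reduced forms are unique (\<open>ex1_reduced_form\<close>, \<open>reduced_form_context\<close>). Hence both sides of
  the associativity axiom for \<open>free_heap X\<close> are the reduced form of the same concatenation of five
  words, and the two cancellation axioms hold because \<open>v @ rev v\<close> and \<open>rev v @ v\<close> cancel to the
  empty word.

  For the universal property, a word \<open>x\<^sub>1 x\<^sub>2 \<dots> x\<^sub>2\<^sub>n\<^sub>+\<^sub>1\<close> of odd length is evaluated in a heap as the
  nested bracket \<open>[\<phi> x\<^sub>1, \<phi> x\<^sub>2, [\<phi> x\<^sub>3, \<phi> x\<^sub>4, \<dots>]]\<close>. This value is invariant under cancellation
  (\<open>word_value_reduced_form\<close>), and the value of \<open>u @ rev v @ w\<close> is the bracket of the three values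
  (\<open>word_value_bracket\<close>), because every heap satisfies \<open>[a, [b, c, d], e] = [[a, d, c], b, e]\<close>.
  So evaluation is a heap morphism. It is the only one that extends \<open>\<phi>\<close>, because a reduced word
  \<open>x # y # w\<close> is itself the bracket of \<open>[x]\<close>, \<open>[y]\<close> and \<open>w\<close> in \<open>free_heap X\<close>.
\<close>

section \<open>Cancellation of words\<close>

lemma cancels_reduced_form: "cancels\<^sup>*\<^sup>* w (reduced_form w)"
  and distinct_adj_reduced_form: "distinct_adj (reduced_form w)"
  using theI'[OF ex1_reduced_form, of w] unfolding reduced_form_def by auto

lemma reduced_form_eqI: "cancels\<^sup>*\<^sup>* w r \<Longrightarrow> distinct_adj r \<Longrightarrow> reduced_form w = r"
  using ex1_reduced_form cancels_reduced_form distinct_adj_reduced_form by blast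

lemma reduced_form_id: "distinct_adj w \<Longrightarrow> reduced_form w = w"
  by (simp add: reduced_form_eqI)

lemma reduced_form_cong:
  assumes "cancels\<^sup>*\<^sup>* w w'"
  shows "reduced_form w = reduced_form w'"
  by (meson assms cancels_reduced_form distinct_adj_reduced_form reduced_form_eqI rtranclp_trans)

lemma cancels_context:
  assumes "cancels w w'"
  shows "cancels (p @ w @ q) (p @ w' @ q)"
  using assms
proof cases
  case (1 u x v)
  show ?thesis using cancels.intros[of "p @ u" x "v @ q"] by (simp add: 1)
qed

lemma rtranclp_cancels_context:
  assumes "cancels\<^sup>*\<^sup>* w w'"
  shows "cancels\<^sup>*\<^sup>* (p @ w @ q) (p @ w' @ q)"
  using assms by induction (auto intro: cancels_context rtranclp.rtrancl_into_rtrancl)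

lemma reduced_form_context: "reduced_form (p @ reduced_form w @ q) = reduced_form (p @ w @ q)"
  by (rule reduced_form_cong[OF rtranclp_cancels_context[OF cancels_reduced_form], symmetric])

lemma cancels_append_rev: "cancels\<^sup>*\<^sup>* (w @ rev w) []"
proof (induction w rule: rev_induct)
  case (snoc x w)
  have "cancels ((w @ [x]) @ rev (w @ [x])) (w @ rev w)"
    using cancels.intros[of w x "rev w"] by simp
  then show ?case using snoc by (rule converse_rtranclp_into_rtranclp)
qed simp

lemma reduced_form_cancel_rev: "reduced_form (p @ w @ rev w @ q) = reduced_form (p @ q)"
  using reduced_form_cong[OF rtranclp_cancels_context[OF cancels_append_rev[of w]], of p q] by simp

lemma cancels_odd_word:
  assumes "cancels w w'" "odd (length w)" "w \<in> lists X"
  shows "odd (length w') \<and> w' \<in> lists X"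
  using assms by cases auto

lemma rtranclp_cancels_odd_word:
  assumes "cancels\<^sup>*\<^sup>* w w'" "odd (length w)" "w \<in> lists X"
  shows "odd (length w') \<and> w' \<in> lists X"
  using assms by induction (auto dest: cancels_odd_word)

lemma reduced_form_in_reduced_words:
  assumes "odd (length w)" "w \<in> lists X"
  shows "reduced_form w \<in> reduced_words X"
  using rtranclp_cancels_odd_word[OF cancels_reduced_form assms] distinct_adj_reduced_form
  by (simp add: reduced_words_def)

section \<open>The heap of reduced words\<close>

lemma heap_free_heap: "heap (free_heap X)"
proof
  fix a b c d e
  assume a: "a \<in> carrier (free_heap X)" and b: "b \<in> carrier (free_heap X)"
  have "reduced_form (a @ rev b @ b) = a" "reduced_form (b @ rev b @ a) = a"
    using reduced_form_cancel_rev[of a "rev b" "[]"] reduced_form_cancel_rev[of "[]" b a] a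
    by (simp_all add: free_heap_def reduced_words_def reduced_form_id)
  then show "bracket (free_heap X) a b b = a" "bracket (free_heap X) b b a = a"
    by (simp_all add: free_heap_def)
  show "bracket (free_heap X) a b c \<in> carrier (free_heap X)" if "c \<in> carrier (free_heap X)"
  proof -
    have "odd (length (a @ rev b @ c))" "a @ rev b @ c \<in> lists X"
      using a b that by (auto simp: free_heap_def reduced_words_def)
    then show ?thesis
      using reduced_form_in_reduced_words[of "a @ rev b @ c" X]
      by (simp del: append_in_lists_conv add: free_heap_def)
  qed
  show "bracket (free_heap X) (bracket (free_heap X) a b c) d e =
      bracket (free_heap X) a b (bracket (free_heap X) c d e)"
    using reduced_form_context[of "[]" "a @ rev b @ c" "rev d @ e"]
      reduced_form_context[of "a @ rev b" "c @ rev d @ e" "[]"]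
    by (simp add: free_heap_def)
qed

section \<open>Evaluation of words in a heap\<close>

lemma odd_length_induct [consumes 1, case_names single step]:
  assumes "odd (length w)"
    and "\<And>x. P [x]"
    and "\<And>x y w. odd (length w) \<Longrightarrow> P w \<Longrightarrow> P (x # y # w)"
  shows "P w"
  using assms(1) by (induction w rule: induct_list012) (auto intro: assms(2,3))

text \<open>The right-nested bracket of the images of the letters of a word of odd length. The
  recursion ends at the empty word, with an arbitrary value, exactly for the words of even length;
  their values have no meaning.\<close>

fun word_value :: "('a, 'm) heap_scheme \<Rightarrow> ('x \<Rightarrow> 'a) \<Rightarrow> 'x list \<Rightarrow> 'a"
  where
    "word_value H \<phi> [] = undefined"
  | "word_value H \<phi> [x] = \<phi> x"
  | "word_value H \<phi> (x # y # w) = bracket H (\<phi> x) (\<phi> y) (word_value H \<phi> w)"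

context heap
begin

lemma bracket_middle:
  assumes H: "a \<in> carrier H" "b \<in> carrier H" "c \<in> carrier H" "d \<in> carrier H" "e \<in> carrier H"
  shows "bracket H a (bracket H b c d) e = bracket H (bracket H a d c) b e"
proof -
  let ?m = "bracket H b c d"
  note closed = H bracket_closed
  have "bracket H (bracket H a d c) b ?m = bracket H a d (bracket H (bracket H c b b) c d)"
    by (simp only: bracket_assoc closed)
  also have "\<dots> = a"
    by (simp add: bracket_cancel_left bracket_cancel_right closed)
  finally have "bracket H a ?m e = bracket H (bracket H (bracket H a d c) b ?m) ?m e"
    by simp
  also have "\<dots> = bracket H (bracket H a d c) b (bracket H ?m ?m e)"
    by (rule bracket_assoc) (simp_all add: closed)
  also have "\<dots> = bracket H (bracket H a d c) b e"
    by (simp add: bracket_cancel_left closed)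
  finally show ?thesis .
qed

lemma word_value_closed:
  assumes "odd (length w)" "w \<in> lists X" "\<phi> \<in> X \<rightarrow> carrier H"
  shows "word_value H \<phi> w \<in> carrier H"
  using assms by (induction w rule: odd_length_induct) (auto intro: bracket_closed)

lemma word_value_bracket:
  assumes odd: "odd (length u)" "odd (length v)" "odd (length w)"
    and words: "u \<in> lists X" "v \<in> lists X" "w \<in> lists X"
    and \<phi>: "\<phi> \<in> X \<rightarrow> carrier H"
  shows "word_value H \<phi> (u @ rev v @ w) =
    bracket H (word_value H \<phi> u) (word_value H \<phi> v) (word_value H \<phi> w)"
  using odd(1) words(1)
proof (induction u rule: odd_length_induct)
  case (single x)
  have "word_value H \<phi> (x # rev v @ w) = bracket H (\<phi> x) (word_value H \<phi> v) (word_value H \<phi> w)"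
    using odd(2,3) words(2,3)
  proof (induction v arbitrary: w rule: odd_length_induct)
    case (step y z v)
    have closed: "\<phi> x \<in> carrier H" "\<phi> y \<in> carrier H" "\<phi> z \<in> carrier H"
      "word_value H \<phi> v \<in> carrier H" "word_value H \<phi> w \<in> carrier H"
      using single step \<phi> by (auto intro: word_value_closed)
    have "word_value H \<phi> (x # rev (y # z # v) @ w) =
        bracket H (\<phi> x) (word_value H \<phi> v) (bracket H (\<phi> z) (\<phi> y) (word_value H \<phi> w))"
      using step.IH[of "z # y # w"] step.prems by simp
    then show ?case
      using closed by (simp add: bracket_middle bracket_assoc)
  qed simp
  then show ?case by simp
next
  case (step x y u)
  have "\<phi> x \<in> carrier H" "\<phi> y \<in> carrier H" "word_value H \<phi> u \<in> carrier H"
    "word_value H \<phi> v \<in> carrier H" "word_value H \<phi> w \<in> carrier H"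
    using step odd words \<phi> by (auto intro: word_value_closed)
  then show ?case
    using step by (simp add: bracket_assoc)
qed

lemma word_value_cancels:
  assumes "cancels w w'" "odd (length w)" "w \<in> lists X" "\<phi> \<in> X \<rightarrow> carrier H"
  shows "word_value H \<phi> w = word_value H \<phi> w'"
  using assms(1)
proof cases
  case (1 u x v)
  have "odd (length (u @ v))" "u @ [x, x] @ v \<in> lists X"
    using assms 1 by auto
  then have "word_value H \<phi> (u @ [x, x] @ v) = word_value H \<phi> (u @ v)"
  proof (induction u rule: induct_list012)
    case 1
    then have "\<phi> x \<in> carrier H" "word_value H \<phi> v \<in> carrier H"
      using assms(4) by (auto intro: word_value_closed)
    then show ?case
      by (simp add: bracket_cancel_left)
  next
    case (2 y)
    \<comment> \<open>Here the cancelled pair starts at an even position, so it straddles two nested brackets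
      unless it ends the word.\<close>
    show ?case
    proof (cases v)
      case Nil
      have "\<phi> y \<in> carrier H" "\<phi> x \<in> carrier H"
        using 2 assms(4) by auto
      then show ?thesis by (simp add: Nil bracket_cancel_right)
    next
      case (Cons z v')
      have "\<phi> y \<in> carrier H" "\<phi> x \<in> carrier H" "\<phi> z \<in> carrier H"
        "word_value H \<phi> v' \<in> carrier H"
        using 2 Cons assms(4) by (auto intro: word_value_closed)
      then show ?thesis
        by (simp add: Cons bracket_assoc[symmetric] bracket_cancel_right)
    qed
  next
    case (3 y z u)
    then show ?case by simp
  qed
  then show ?thesis by (simp add: 1)
qed

lemma word_value_reduced_form:
  assumes "odd (length w)" "w \<in> lists X" "\<phi> \<in> X \<rightarrow> carrier H"
  shows "word_value H \<phi> (reduced_form w) = word_value H \<phi> w"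
proof -
  have "word_value H \<phi> w' = word_value H \<phi> w" if "cancels\<^sup>*\<^sup>* w w'" for w'
    using that
  proof induction
    case (step w' w'')
    then show ?case
      using word_value_cancels[of w' w''] rtranclp_cancels_odd_word[of w w'] assms by metis
  qed simp
  then show ?thesis using cancels_reduced_form by blast
qed

lemma word_value_hom:
  assumes "\<phi> \<in> X \<rightarrow> carrier H"
  shows "restrict (word_value H \<phi>) (carrier (free_heap X)) \<in> heap_hom (free_heap X) H"
proof -
  have "word_value H \<phi> (reduced_form (u @ rev v @ w)) =
      bracket H (word_value H \<phi> u) (word_value H \<phi> v) (word_value H \<phi> w)"
    if "u \<in> reduced_words X" "v \<in> reduced_words X" "w \<in> reduced_words X" for u v w
  proof -
    have "word_value H \<phi> (reduced_form (u @ rev v @ w)) = word_value H \<phi> (u @ rev v @ w)"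
      by (rule word_value_reduced_form[OF _ _ assms])
        (use that in \<open>auto simp: reduced_words_def\<close>)
    then show ?thesis
      using that word_value_bracket[OF _ _ _ _ _ _ assms] by (simp add: reduced_words_def)
  qed
  moreover have "reduced_form (u @ rev v @ w) \<in> reduced_words X"
    if "u \<in> reduced_words X" "v \<in> reduced_words X" "w \<in> reduced_words X" for u v w
    using heap.bracket_closed[OF heap_free_heap, of u X v w] that by (simp add: free_heap_def)
  moreover have "word_value H \<phi> w \<in> carrier H" if "w \<in> reduced_words X" for w
    using that assms by (auto simp: reduced_words_def intro: word_value_closed)
  ultimately show ?thesis
    by (simp add: heap_hom_def free_heap_def)
qed

lemma hom_eq_word_value:
  assumes f: "f \<in> heap_hom (free_heap X) H" "\<And>x. x \<in> X \<Longrightarrow> f [x] = \<phi> x"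
    and w: "w \<in> reduced_words X"
  shows "f w = word_value H \<phi> w"
proof -
  have "odd (length w)" "w \<in> lists X" "distinct_adj w"
    using w by (auto simp: reduced_words_def)
  then show ?thesis
  proof (induction w rule: odd_length_induct)
    case (single x)
    then show ?case using f(2) by simp
  next
    case (step x y w)
    have reduced: "distinct_adj w"
      using step.prems(2) by (auto simp: distinct_adj_Cons)
    then have "[x] \<in> reduced_words X" "[y] \<in> reduced_words X" "w \<in> reduced_words X"
      using step by (auto simp: reduced_words_def)
    then have "f (reduced_form (x # y # w)) = bracket H (f [x]) (f [y]) (f w)"
      using f(1) by (force simp: heap_hom_def free_heap_def)
    then show ?case
      using step reduced f(2) by (simp add: reduced_form_id)
  qed
qed

end

section \<open>The universal property\<close>

theorem lemma3p1:
  fixes X :: "'a set"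
  assumes "X \<noteq> {}"
  shows "heap (free_heap X) \<and> letter \<in> X \<rightarrow> carrier (free_heap X) \<and>
    (\<forall>(H :: 'h heap) \<phi>. heap H \<longrightarrow> \<phi> \<in> X \<rightarrow> carrier H \<longrightarrow>
      (\<exists>!f. f \<in> extensional (carrier (free_heap X)) \<and> f \<in> heap_hom (free_heap X) H \<and>
        (\<forall>x\<in>X. (f \<circ> letter) x = \<phi> x)))"
proof (intro conjI allI impI)
  show "heap (free_heap X)" by (rule heap_free_heap)
  show letter: "letter \<in> X \<rightarrow> carrier (free_heap X)"
    by (auto simp: letter_def free_heap_def reduced_words_def)
  fix H :: "'h heap" and \<phi>
  assume "heap H" and \<phi>: "\<phi> \<in> X \<rightarrow> carrier H"
  interpret heap H by fact
  let ?g = "restrict (word_value H \<phi>) (carrier (free_heap X))"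
  show "\<exists>!f. f \<in> extensional (carrier (free_heap X)) \<and> f \<in> heap_hom (free_heap X) H \<and>
      (\<forall>x\<in>X. (f \<circ> letter) x = \<phi> x)"
  proof (rule ex1I[of _ ?g])
    have "(?g \<circ> letter) x = \<phi> x" if "x \<in> X" for x
      using funcset_mem[OF letter that] by (simp add: letter_def)
    then show "?g \<in> extensional (carrier (free_heap X)) \<and> ?g \<in> heap_hom (free_heap X) H \<and>
        (\<forall>x\<in>X. (?g \<circ> letter) x = \<phi> x)"
      using word_value_hom[OF \<phi>] by simp
  next
    fix f
    assume f: "f \<in> extensional (carrier (free_heap X)) \<and> f \<in> heap_hom (free_heap X) H \<and>
      (\<forall>x\<in>X. (f \<circ> letter) x = \<phi> x)"
    show "f = ?g"
    proof (rule extensionalityI[of _ "carrier (free_heap X)"])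
      fix w
      assume w: "w \<in> carrier (free_heap X)"
      have "f w = word_value H \<phi> w"
        by (rule hom_eq_word_value[of f X])
          (use f w in \<open>auto simp: letter_def free_heap_def\<close>)
      then show "f w = ?g w" using w by simp
    qed (use f in simp_all)
  qed
qed

end
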